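(* Let $V=\mathbb R^{2n}$ with a symplectic form $\omega$, let $H\subset\mathrm{Aff}(\mathbb R^{2n})$ be an Abelian simply transitive affine group of symplectic type, and let $S\in S^3V$ be the cubic form defined by $H$. Then the subgroup of translations in $H$ is of dimension $2n-k$, where $k=\dim\Sigma_S\le n$.
   Context: An affine group of symplectic type is a connected Lie subgroup $H$ of the group of affine transformations of $V$ with linear part in $\mathrm{Sp}(V)$; it is simply transitive if the orbit map $\varphi:H\to V$, $h\mapsto h0$, is a diffeomorphism. For $H$ Abelian simply transitive with Lie algebra $\mathfrak h\subset\mathfrak{sp}(V)\ltimes V$ and $\phi=d\varphi:\mathfrak h\to V$ (an isomorphism), one has $\phi^{-1}(X)=(S_X,X)$ with linear part $S_X\in\mathfrak{sp}(V)$, and $S_XY=S_YX$. The map $S:X\mapsto S_X$ is identified with the cubic form $(X,Y,Z)\mapsto\omega(S_XY,Z)$ in $S^3V^*$, and with an element of $S^3V$ via $V\cong V^*$, $v\mapsto\omega(v,\cdot)$. This is the cubic form defined by $H$. Its support is $\Sigma_S=\mathrm{span}\{S_XY\mid X,Y\in V\}$. *)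

theory Defs
  imports "HOL-Analysis.Analysis" "HOL-Algebra.Group"
begin

subsection \<open>Smooth manifolds modelled on a Euclidean space\<close>

text \<open>For open sets \<open>S\<close> this is the usual notion of a \<open>k\<close> times continuously differentiable map.\<close>

primrec Ck_on :: "nat \<Rightarrow> 'a::euclidean_space set \<Rightarrow> ('a \<Rightarrow> 'b::real_normed_vector) \<Rightarrow> bool" where
  "Ck_on 0 S f \<longleftrightarrow> continuous_on S f"
| "Ck_on (Suc k) S f \<longleftrightarrow> (\<forall>x\<in>S. f differentiable (at x)) \<and>
     (\<forall>v. Ck_on k S (\<lambda>x. frechet_derivative f (at x) v))"

text \<open>Openness of the domain is part of the definition; \<open>smooth_map\<close> and \<open>smooth_atlas\<close> rely on this.\<close>

definition smooth_on :: "'a::euclidean_space set \<Rightarrow> ('a \<Rightarrow> 'b::real_normed_vector) \<Rightarrow> bool" where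
  "smooth_on S f \<longleftrightarrow> open S \<and> (\<forall>k. Ck_on k S f)"

text \<open>A chart is a pair \<open>(U, c)\<close> of a chart domain and a coordinate map, of which only the values
  on \<open>U\<close> matter.\<close>

type_synonym ('x, 'e) atlas = "('x set \<times> ('x \<Rightarrow> 'e)) set"

definition smooth_atlas :: "'x set \<Rightarrow> ('x, 'e::euclidean_space) atlas \<Rightarrow> bool" where
  "smooth_atlas M \<A> \<longleftrightarrow>
     (\<Union>(U, c)\<in>\<A>. U) = M \<and>
     (\<forall>(U, c)\<in>\<A>. inj_on c U) \<and>
     (\<forall>(U, c)\<in>\<A>. \<forall>(U', c')\<in>\<A>. smooth_on (c ` (U \<inter> U')) (c' \<circ> the_inv_into U c))"

definition manifold_topology :: "'x set \<Rightarrow> ('x, 'e::euclidean_space) atlas \<Rightarrow> 'x topology" where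
  "manifold_topology M \<A> = topology (\<lambda>W. W \<subseteq> M \<and> (\<forall>(U, c)\<in>\<A>. open (c ` (U \<inter> W))))"

lemma istopology_manifold_topology:
  assumes "smooth_atlas M \<A>"
  shows "istopology (\<lambda>W. W \<subseteq> M \<and> (\<forall>(U, c)\<in>\<A>. open (c ` (U \<inter> W))))"
  unfolding istopology_def
proof (intro conjI allI impI)
  fix S T
  assume S: "S \<subseteq> M \<and> (\<forall>(U, c)\<in>\<A>. open (c ` (U \<inter> S)))"
    and T: "T \<subseteq> M \<and> (\<forall>(U, c)\<in>\<A>. open (c ` (U \<inter> T)))"
  show "S \<inter> T \<subseteq> M" using S by blast
  show "\<forall>(U, c)\<in>\<A>. open (c ` (U \<inter> (S \<inter> T)))"
  proof clarify
    fix U c assume "(U, c) \<in> \<A>"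
    then have "inj_on c U" "open (c ` (U \<inter> S))" "open (c ` (U \<inter> T))"
      using assms S T by (auto simp: smooth_atlas_def)
    moreover from this(1) have "c ` (U \<inter> (S \<inter> T)) = c ` (U \<inter> S) \<inter> c ` (U \<inter> T)"
      by (auto dest: inj_onD)
    ultimately show "open (c ` (U \<inter> (S \<inter> T)))" by (simp add: open_Int)
  qed
next
  fix K
  assume K: "\<forall>W\<in>K. W \<subseteq> M \<and> (\<forall>(U, c)\<in>\<A>. open (c ` (U \<inter> W)))"
  show "\<Union>K \<subseteq> M" using K by blast
  show "\<forall>(U, c)\<in>\<A>. open (c ` (U \<inter> \<Union>K))"
  proof clarify
    fix U c assume "(U, c) \<in> \<A>"
    then have "\<forall>W\<in>K. open (c ` (U \<inter> W))" using K by blast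
    then have "open (\<Union>W\<in>K. c ` (U \<inter> W))" by (rule open_UN)
    moreover have "c ` (U \<inter> \<Union>K) = (\<Union>W\<in>K. c ` (U \<inter> W))" by blast
    ultimately show "open (c ` (U \<inter> \<Union>K))" by simp
  qed
qed

definition smooth_manifold :: "'x set \<Rightarrow> ('x, 'e::euclidean_space) atlas \<Rightarrow> bool" where
  "smooth_manifold M \<A> \<longleftrightarrow> smooth_atlas M \<A> \<and>
     Hausdorff_space (manifold_topology M \<A>) \<and> second_countable (manifold_topology M \<A>)"

text \<open>An open subset of a Euclidean space, with its standard smooth structure.\<close>

definition open_atlas :: "'e::euclidean_space set \<Rightarrow> ('e, 'e) atlas" where
  "open_atlas U = {(U, \<lambda>x. x)}"

definition prod_atlas ::
    "('x, 'e::euclidean_space) atlas \<Rightarrow> ('y, 'f::euclidean_space) atlas \<Rightarrow> ('x \<times> 'y, 'e \<times> 'f) atlas" where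
  "prod_atlas \<A> \<B> = {(U \<times> V, map_prod c d) | U c V d. (U, c) \<in> \<A> \<and> (V, d) \<in> \<B>}"

text \<open>Since \<open>smooth_on\<close> includes openness of \<open>c ` (U \<inter> f -` V)\<close>, continuity of \<open>f\<close> in the
  manifold topologies is part of this definition.\<close>

definition smooth_map :: "'x set \<Rightarrow> ('x, 'e::euclidean_space) atlas \<Rightarrow>
    'y set \<Rightarrow> ('y, 'f::euclidean_space) atlas \<Rightarrow> ('x \<Rightarrow> 'y) \<Rightarrow> bool" where
  "smooth_map M \<A> N \<B> f \<longleftrightarrow> f ` M \<subseteq> N \<and>
     (\<forall>(U, c)\<in>\<A>. \<forall>(V, d)\<in>\<B>. smooth_on (c ` (U \<inter> f -` V)) (d \<circ> f \<circ> the_inv_into U c))"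

definition diffeomorphism :: "'x set \<Rightarrow> ('x, 'e::euclidean_space) atlas \<Rightarrow>
    'y set \<Rightarrow> ('y, 'f::euclidean_space) atlas \<Rightarrow> ('x \<Rightarrow> 'y) \<Rightarrow> bool" where
  "diffeomorphism M \<A> N \<B> f \<longleftrightarrow> bij_betw f M N \<and>
     smooth_map M \<A> N \<B> f \<and> smooth_map N \<B> M \<A> (the_inv_into M f)"

definition immersion :: "'x set \<Rightarrow> ('x, 'e::euclidean_space) atlas \<Rightarrow>
    'y set \<Rightarrow> ('y, 'f::euclidean_space) atlas \<Rightarrow> ('x \<Rightarrow> 'y) \<Rightarrow> bool" where
  "immersion M \<A> N \<B> f \<longleftrightarrow> smooth_map M \<A> N \<B> f \<and>
     (\<forall>(U, c)\<in>\<A>. \<forall>(V, d)\<in>\<B>. \<forall>x \<in> c ` (U \<inter> f -` V).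
        inj (frechet_derivative (d \<circ> f \<circ> the_inv_into U c) (at x)))"

text \<open>The slice condition, where \<open>(U, c)\<close> ranges over the charts of the maximal atlas.\<close>

definition embedded_submanifold ::
    "'x set \<Rightarrow> ('x, 'e::euclidean_space) atlas \<Rightarrow> 'x set \<Rightarrow> nat \<Rightarrow> bool" where
  "embedded_submanifold M \<A> T d \<longleftrightarrow> T \<subseteq> M \<and>
     (\<forall>p\<in>T. \<exists>U c W. p \<in> U \<and> smooth_atlas M (insert (U, c) \<A>) \<and>
        subspace W \<and> dim W = d \<and> c ` (U \<inter> T) = c ` U \<inter> W)"

text \<open>For an immersed submanifold of a Euclidean space, the image of the tangent space at \<open>p\<close> under
  the differential of the inclusion.\<close>

definition tangent_space :: "('x::euclidean_space, 'e::euclidean_space) atlas \<Rightarrow> 'x \<Rightarrow> 'x set" where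
  "tangent_space \<A> p =
     {frechet_derivative (the_inv_into U c) (at (c p)) w | U c w. (U, c) \<in> \<A> \<and> p \<in> U}"


subsection \<open>Lie groups\<close>

definition lie_group :: "('x, 'r) monoid_scheme \<Rightarrow> ('x, 'e::euclidean_space) atlas \<Rightarrow> bool" where
  "lie_group G \<A> \<longleftrightarrow> group G \<and> smooth_manifold (carrier G) \<A> \<and>
     smooth_map (carrier G \<times> carrier G) (prod_atlas \<A> \<A>) (carrier G) \<A> (\<lambda>(x, y). x \<otimes>\<^bsub>G\<^esub> y) \<and>
     smooth_map (carrier G) \<A> (carrier G) \<A> (\<lambda>x. inv\<^bsub>G\<^esub> x)"

text \<open>Lie subgroups are immersed, with a smooth structure \<open>\<A>\<close> of their own.\<close>

definition lie_subgroup :: "('x, 'r) monoid_scheme \<Rightarrow> ('x, 'f::euclidean_space) atlas \<Rightarrow>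
    'x set \<Rightarrow> ('x, 'e::euclidean_space) atlas \<Rightarrow> bool" where
  "lie_subgroup G \<B> H \<A> \<longleftrightarrow> subgroup H G \<and> lie_group (G\<lparr>carrier := H\<rparr>) \<A> \<and>
     immersion H \<A> (carrier G) \<B> (\<lambda>x. x)"

definition connected_lie_subgroup :: "('x, 'r) monoid_scheme \<Rightarrow> ('x, 'f::euclidean_space) atlas \<Rightarrow>
    'x set \<Rightarrow> ('x, 'e::euclidean_space) atlas \<Rightarrow> bool" where
  "connected_lie_subgroup G \<B> H \<A> \<longleftrightarrow>
     lie_subgroup G \<B> H \<A> \<and> connected_space (manifold_topology H \<A>)"

definition embedded_lie_subgroup_of_dim :: "('x, 'r) monoid_scheme \<Rightarrow>
    ('x, 'e::euclidean_space) atlas \<Rightarrow> 'x set \<Rightarrow> nat \<Rightarrow> bool" where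
  "embedded_lie_subgroup_of_dim G \<A> T d \<longleftrightarrow>
     subgroup T G \<and> embedded_submanifold (carrier G) \<A> T d"


subsection \<open>Affine groups of symplectic type\<close>

definition symplectic_form :: "('v::euclidean_space \<Rightarrow> 'v \<Rightarrow> real) \<Rightarrow> bool" where
  "symplectic_form \<omega> \<longleftrightarrow> bilinear \<omega> \<and> (\<forall>x. \<omega> x x = 0) \<and> (\<forall>x. (\<forall>y. \<omega> x y = 0) \<longrightarrow> x = 0)"

text \<open>The pair \<open>(A, v)\<close> stands for the affine map \<open>x \<mapsto> A x + v\<close>, and also, in the Lie algebra, for the
  affine vector field with linear part \<open>A\<close> and translation part \<open>v\<close>.\<close>

type_synonym 'm aff = "(real^'m^'m) \<times> (real^'m)"

definition aff_apply :: "'m::finite aff \<Rightarrow> real^'m \<Rightarrow> real^'m" where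
  "aff_apply h x = fst h *v x + snd h"

definition aff_group :: "'m::finite aff monoid" where
  "aff_group = \<lparr>carrier = {h. invertible (fst h)},
     mult = (\<lambda>g h. (fst g ** fst h, fst g *v snd h + snd g)),
     one = (mat 1, 0)\<rparr>"

lemma aff_apply_mult: "aff_apply (g \<otimes>\<^bsub>aff_group\<^esub> h) x = aff_apply g (aff_apply h x)"
  by (simp add: aff_apply_def aff_group_def matrix_vector_right_distrib matrix_vector_mul_assoc)

definition affine_group_of_symplectic_type :: "(real^'m \<Rightarrow> real^'m \<Rightarrow> real) \<Rightarrow>
    'm::finite aff set \<Rightarrow> ('m aff, 'e::euclidean_space) atlas \<Rightarrow> bool" where
  "affine_group_of_symplectic_type \<omega> H \<A> \<longleftrightarrow>
     connected_lie_subgroup aff_group (open_atlas (carrier aff_group)) H \<A> \<and>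
     (\<forall>h\<in>H. \<forall>x y. \<omega> (fst h *v x) (fst h *v y) = \<omega> x y)"

definition orbit_map :: "'m::finite aff \<Rightarrow> real^'m" where
  "orbit_map h = aff_apply h 0"

definition simply_transitive :: "'m::finite aff set \<Rightarrow> ('m aff, 'e::euclidean_space) atlas \<Rightarrow> bool" where
  "simply_transitive H \<A> \<longleftrightarrow> diffeomorphism H \<A> UNIV (open_atlas UNIV) orbit_map"

definition translation_subgroup :: "'m::finite aff set \<Rightarrow> 'm aff set" where
  "translation_subgroup H = {h \<in> H. fst h = mat 1}"


subsection \<open>The cubic form of a simply transitive group\<close>

definition lie_algebra :: "('m::finite aff, 'e::euclidean_space) atlas \<Rightarrow> 'm aff set" where
  "lie_algebra \<A> = tangent_space \<A> \<one>\<^bsub>aff_group\<^esub>"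

text \<open>The matrix \<open>S\<^sub>X\<close> with \<open>\<phi>\<^sup>-\<^sup>1 X = (S\<^sub>X, X)\<close>, where \<open>\<phi>\<close> is the differential of the orbit map at
  the identity, restricted to the Lie algebra.\<close>

definition linear_part_of :: "('m::finite aff, 'e::euclidean_space) atlas \<Rightarrow> real^'m \<Rightarrow> real^'m^'m" where
  "linear_part_of \<A> X =
     fst (the_inv_into (lie_algebra \<A>) (frechet_derivative orbit_map (at \<one>\<^bsub>aff_group\<^esub>)) X)"

definition cubic_form :: "(real^'m \<Rightarrow> real^'m \<Rightarrow> real) \<Rightarrow> ('m::finite aff, 'e::euclidean_space) atlas \<Rightarrow>
    real^'m \<Rightarrow> real^'m \<Rightarrow> real^'m \<Rightarrow> real" where
  "cubic_form \<omega> \<A> X Y Z = \<omega> (linear_part_of \<A> X *v Y) Z"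

text \<open>The endomorphisms \<open>S\<^sub>X\<close> are recovered from the cubic form by the isomorphism of \<open>V\<close> with its
  dual given by \<open>v \<mapsto> \<omega>(v, \<cdot>)\<close>, which is \<open>\<omega>\<close> itself as a curried function.\<close>

definition form_to_endo :: "('v::euclidean_space \<Rightarrow> 'v \<Rightarrow> real) \<Rightarrow>
    ('v \<Rightarrow> 'v \<Rightarrow> 'v \<Rightarrow> real) \<Rightarrow> 'v \<Rightarrow> 'v \<Rightarrow> 'v" where
  "form_to_endo \<omega> S X Y = the_inv_into UNIV \<omega> (S X Y)"

definition cubic_support :: "('v::euclidean_space \<Rightarrow> 'v \<Rightarrow> real) \<Rightarrow>
    ('v \<Rightarrow> 'v \<Rightarrow> 'v \<Rightarrow> real) \<Rightarrow> 'v set" where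
  "cubic_support \<omega> S = span {form_to_endo \<omega> S X Y | X Y. True}"

lemma inj_symplectic_form: "symplectic_form \<omega> \<Longrightarrow> inj \<omega>"
proof (rule injI)
  fix x y
  assume s: "symplectic_form \<omega>" and "\<omega> x = \<omega> y"
  then have "\<omega> (x - y) z = 0" for z
    by (simp add: symplectic_form_def bilinear_lsub)
  then have "x - y = 0"
    using s unfolding symplectic_form_def by blast
  then show "x = y" by simp
qed

lemma cubic_support_cubic_form:
  assumes "symplectic_form \<omega>"
  shows "cubic_support \<omega> (cubic_form \<omega> \<A>) = span {linear_part_of \<A> X *v Y | X Y. True}"
proof -
  have "cubic_form \<omega> \<A> X Y = \<omega> (linear_part_of \<A> X *v Y)" for X Y
    by (rule ext) (simp add: cubic_form_def)
  then show ?thesis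
    by (simp add: cubic_support_def form_to_endo_def the_inv_into_f_f[OF inj_symplectic_form[OF assms]])
qed

end

theory Submission
  imports Defs
begin

text \<open>Commutativity forces the orbit map to have an affine inverse \<open>u \<mapsto> (1 + B\<^sub>u, u)\<close>, with \<open>B\<close>
  linear; so \<open>S\<^sub>X = B\<^sub>X\<close>, and the translations in \<open>H\<close> are the kernel of \<open>B\<close> in the global chart given
  by the orbit map. Since \<open>\<omega>(B\<^sub>u x, y)\<close> is totally symmetric, \<open>ker B\<close> is the symplectic complement of
  the support, and since all products \<open>B\<^sub>u B\<^sub>v\<close> vanish the support lies in \<open>ker B\<close>, that is, it is
  isotropic.\<close>

section \<open>Iterated differentiability under linear changes of variable\<close>

text \<open>Openness is essential: around each point of \<open>S\<close> the two functions agree on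
  a neighbourhood, so their derivatives agree on \<open>S\<close> as well and the induction can be
  repeated for these.\<close>

lemma Ck_on_cong:
  assumes "open S" "Ck_on k S f" "\<And>x. x \<in> S \<Longrightarrow> f x = g x"
  shows "Ck_on k S g"
  using assms(2,3)
proof (induction k arbitrary: f g)
  case 0
  then show ?case using continuous_on_cong[of S S f g] by simp
next
  case (Suc k)
  have D: "(g has_derivative frechet_derivative f (at x)) (at x)" if "x \<in> S" for x
  proof (rule has_derivative_transform_within_open[OF _ assms(1) that])
    show "(f has_derivative frechet_derivative f (at x)) (at x)"
      using Suc.prems(1) that frechet_derivative_works by auto
  qed (rule Suc.prems(2))
  have "Ck_on k S (\<lambda>x. frechet_derivative g (at x) v)" for v
  proof (rule Suc.IH)
    show "Ck_on k S (\<lambda>x. frechet_derivative f (at x) v)" using Suc.prems by simp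
  qed (simp add: frechet_derivative_at[OF D])
  then show ?case using D by (auto simp: differentiable_def)
qed

lemma Ck_on_linear_comp:
  assumes "open S" "bounded_linear L" "Ck_on k S f"
  shows "Ck_on k S (\<lambda>x. L (f x))"
  using assms(3)
proof (induction k arbitrary: f)
  case 0
  then show ?case using bounded_linear.continuous_on[OF assms(2)] by simp
next
  case (Suc k)
  have D: "((\<lambda>x. L (f x)) has_derivative (\<lambda>v. L (frechet_derivative f (at x) v))) (at x)"
    if "x \<in> S" for x
    using Suc.prems that
    by (auto simp: frechet_derivative_works intro!: bounded_linear.has_derivative[OF assms(2)])
  have "Ck_on k S (\<lambda>x. frechet_derivative (\<lambda>x. L (f x)) (at x) v)" for v
  proof (rule Ck_on_cong[OF assms(1)])
    show "Ck_on k S (\<lambda>x. L (frechet_derivative f (at x) v))" using Suc by simp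
  qed (simp add: frechet_derivative_at[OF D, symmetric])
  then show ?case using D by (auto simp: differentiable_def)
qed

lemma Ck_on_comp_linear:
  assumes "open S" "bounded_linear M" "Ck_on k S f"
  shows "Ck_on k (M -` S) (\<lambda>x. f (M x))"
  using assms(3)
proof (induction k arbitrary: f)
  case 0
  then show ?case
    using continuous_on_compose2[of S f _ M] linear_continuous_on[OF assms(2)] by auto
next
  case (Suc k)
  have "open (M -` S)"
    using assms(1,2) by (simp add: continuous_open_vimage linear_continuous_at)
  have D: "((\<lambda>x. f (M x)) has_derivative (\<lambda>v. frechet_derivative f (at (M x)) (M v))) (at x)"
    if "M x \<in> S" for x
    using Suc.prems that
    by (auto simp: frechet_derivative_works
        intro!: has_derivative_compose[OF bounded_linear_imp_has_derivative[OF assms(2)]])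
  \<comment> \<open>For fixed \<open>v\<close> the direction \<open>M v\<close> does not depend on
    the point, so this derivative is again a function precomposed with \<open>M\<close>.\<close>
  have "Ck_on k (M -` S) (\<lambda>x. frechet_derivative (\<lambda>x. f (M x)) (at x) v)" for v
  proof (rule Ck_on_cong[OF \<open>open (M -` S)\<close>])
    show "Ck_on k (M -` S) (\<lambda>x. frechet_derivative f (at (M x)) (M v))"
      using Suc.IH[of "\<lambda>y. frechet_derivative f (at y) (M v)"] Suc.prems by simp
  qed (simp add: frechet_derivative_at[OF D, symmetric])
  then show ?case using D by (auto simp: differentiable_def)
qed

lemma Ck_on_const: "Ck_on k S (\<lambda>x. c)"
  by (induction k arbitrary: c) (simp_all add: frechet_derivative_const)

lemma smooth_on_id: "smooth_on UNIV (\<lambda>x. x)"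
proof -
  have "Ck_on k UNIV (\<lambda>x::'a. x)" for k
    by (cases k) (simp_all add: Ck_on_const frechet_derivative_ident)
  then show ?thesis by (simp add: smooth_on_def)
qed

lemma smooth_on_linear_comp:
  "smooth_on S f \<Longrightarrow> linear L \<Longrightarrow> smooth_on S (\<lambda>x. L (f x))"
  for f :: "'a::euclidean_space \<Rightarrow> 'b::euclidean_space"
  by (simp add: smooth_on_def Ck_on_linear_comp linear_conv_bounded_linear)

lemma smooth_on_comp_linear:
  "smooth_on S f \<Longrightarrow> linear M \<Longrightarrow> smooth_on (M -` S) (\<lambda>x. f (M x))"
  for M :: "'a::euclidean_space \<Rightarrow> 'b::euclidean_space"
  by (simp add: smooth_on_def Ck_on_comp_linear linear_conv_bounded_linear
      continuous_open_vimage linear_continuous_at)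

lemma smooth_on_imp_differentiable:
  assumes "smooth_on S f" "x \<in> S"
  shows "f differentiable (at x)"
  using assms Ck_on.simps(2)[of 0 S f] unfolding smooth_on_def by blast

section \<open>Global diffeomorphisms onto a vector space, seen in charts\<close>

lemma diffeomorphism_onto_UNIV_D:
  assumes f: "diffeomorphism M \<A> UNIV (open_atlas UNIV) f" and c: "(U, c) \<in> \<A>"
  shows "bij_betw f M UNIV"
    and "smooth_on (c ` U) (\<lambda>y. f (the_inv_into U c y))"
    and "smooth_on {v. the_inv_into M f v \<in> U} (\<lambda>v. c (the_inv_into M f v))"
proof -
  have [simp]: "the_inv_into UNIV (\<lambda>x. x) = (\<lambda>x. x)"
    by (rule ext) (simp add: the_inv_into_f_f[of "\<lambda>x. x", simplified])
  have "smooth_map M \<A> UNIV (open_atlas UNIV) f"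
    and "smooth_map UNIV (open_atlas UNIV) M \<A> (the_inv_into M f)"
    using f by (auto simp: diffeomorphism_def)
  with c show "smooth_on (c ` U) (\<lambda>y. f (the_inv_into U c y))"
    and "smooth_on {v. the_inv_into M f v \<in> U} (\<lambda>v. c (the_inv_into M f v))"
    by (fastforce simp: smooth_map_def open_atlas_def o_def vimage_def)+
  show "bij_betw f M UNIV" using f by (simp add: diffeomorphism_def)
qed

text \<open>A diffeomorphism onto a vector space is itself a chart on all of \<open>M\<close>. The
  isomorphism \<open>L\<close> only moves its values into the model space \<open>'e\<close> of the
  atlas. Transition maps are the coordinate expressions of \<open>f\<close> and of its inverse,
  composed with \<open>L\<close> or \<open>L'\<close>.\<close>

lemma smooth_atlas_insert_global_chart:
  fixes L :: "'v::euclidean_space \<Rightarrow> 'e::euclidean_space"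
  assumes A: "smooth_atlas M \<A>" and f: "diffeomorphism M \<A> UNIV (open_atlas UNIV) f"
    and L: "linear L" "linear L'" "\<And>x. L' (L x) = x" "\<And>y. L (L' y) = y"
  shows "smooth_atlas M (insert (M, \<lambda>x. L (f x)) \<A>)"
proof -
  have bij: "bij_betw f M UNIV" using f by (simp add: diffeomorphism_def)
  have inv: "the_inv_into M f v \<in> M" "f (the_inv_into M f v) = v" for v
    using bij bij_betw_apply[OF bij_betw_the_inv_into[OF bij]] f_the_inv_into_f_bij_betw[OF bij]
    by auto
  have inj: "inj_on (\<lambda>x. L (f x)) M"
    using bij L(3) by (auto simp: bij_betw_def inj_on_def) metis
  have im: "(\<lambda>x. L (f x)) ` M = UNIV"
    using inv L(4) by (metis UNIV_eq_I image_eqI)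
  have inv': "the_inv_into M (\<lambda>x. L (f x)) y = the_inv_into M f (L' y)" for y
    by (rule the_inv_into_f_eq[OF inj]) (simp_all add: inv L(4))
  have U: "U \<subseteq> M" "inj_on c U" if "(U, c) \<in> \<A>" for U c
    using A that by (auto simp: smooth_atlas_def)
  have self: "smooth_on ((\<lambda>x. L (f x)) ` (M \<inter> M)) ((\<lambda>x. L (f x)) \<circ> the_inv_into M (\<lambda>x. L (f x)))"
    using im by (auto simp: inv' inv L(4) o_def intro: smooth_on_id)
  have from_global: "smooth_on ((\<lambda>x. L (f x)) ` (M \<inter> U)) (c \<circ> the_inv_into M (\<lambda>x. L (f x)))"
    if c: "(U, c) \<in> \<A>" for U c
  proof -
    have "L' -` {v. the_inv_into M f v \<in> U} = (\<lambda>x. L (f x)) ` (M \<inter> U)"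
    proof (intro equalityI subsetI)
      fix y assume "y \<in> L' -` {v. the_inv_into M f v \<in> U}"
      then show "y \<in> (\<lambda>x. L (f x)) ` (M \<inter> U)"
        by (intro image_eqI[where x = "the_inv_into M f (L' y)"]) (auto simp: inv L(4))
    qed (use bij L(3) in \<open>auto simp: bij_betw_def the_inv_into_f_f\<close>)
    then show ?thesis
      using smooth_on_comp_linear[OF diffeomorphism_onto_UNIV_D(3)[OF f c] L(2)]
      by (simp add: inv' o_def)
  qed
  have to_global: "smooth_on (c ` (U \<inter> M)) ((\<lambda>x. L (f x)) \<circ> the_inv_into U c)"
    if c: "(U, c) \<in> \<A>" for U c
    using smooth_on_linear_comp[OF diffeomorphism_onto_UNIV_D(2)[OF f c] L(1)] U(1)[OF c]
    by (simp add: o_def Int_absorb2)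
  show ?thesis
    using A self from_global to_global inj unfolding smooth_atlas_def by auto
qed

text \<open>The coordinate expressions of \<open>f\<close> and its inverse undo each other on open
  sets, so by the chain rule their derivatives do too. In particular \<open>'e\<close> and
  \<open>'v\<close> are linearly isomorphic, although the types do not force this.\<close>

lemma diffeomorphism_derivative_in_chart:
  fixes \<A> :: "('x, 'e::euclidean_space) atlas" and f :: "'x \<Rightarrow> 'v::euclidean_space"
  assumes A: "smooth_atlas M \<A>" and f: "diffeomorphism M \<A> UNIV (open_atlas UNIV) f"
    and c: "(U, c) \<in> \<A>" and p: "p \<in> U"
  obtains g' h' where "((\<lambda>y. f (the_inv_into U c y)) has_derivative g') (at (c p))"
    "linear g'" "linear h'" "\<And>v. g' (h' v) = v" "\<And>w. h' (g' w) = w"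
proof -
  note D = diffeomorphism_onto_UNIV_D[OF f c]
  let ?g = "\<lambda>y. f (the_inv_into U c y)" and ?h = "\<lambda>v. c (the_inv_into M f v)"
  let ?T = "{v. the_inv_into M f v \<in> U}"
  have U: "U \<subseteq> M" "inj_on c U" using A c by (auto simp: smooth_atlas_def)
  have inj: "inj_on f M" using D(1) by (simp add: bij_betw_def)
  have fp: "the_inv_into M f (f p) = p" using U p inj by (auto intro: the_inv_into_f_f)
  have cp: "the_inv_into U c (c p) = p" using U p by (auto intro: the_inv_into_f_f)
  obtain g' where g': "(?g has_derivative g') (at (c p))"
    using smooth_on_imp_differentiable[OF D(2)] p by (auto simp: differentiable_def)
  obtain h' where h': "(?h has_derivative h') (at (f p))"
    using smooth_on_imp_differentiable[OF D(3), of "f p"] p fp by (auto simp: differentiable_def)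
  have op: "open (c ` U)" "open ?T" using D(2,3) by (simp_all add: smooth_on_def)
  have "((\<lambda>v. ?g (?h v)) has_derivative (\<lambda>v. g' (h' v))) (at (f p))"
    using has_derivative_compose[OF h', of ?g g'] g' fp by simp
  then have "((\<lambda>v. v) has_derivative (\<lambda>v. g' (h' v))) (at (f p))"
    by (rule has_derivative_transform_within_open[OF _ op(2)])
      (use fp p U in \<open>auto simp: the_inv_into_f_f f_the_inv_into_f_bij_betw[OF D(1)]\<close>)
  then have "(\<lambda>v. g' (h' v)) = (\<lambda>v. v)" by (rule has_derivative_unique[OF _ has_derivative_ident])
  then have gh: "g' (h' v) = v" for v by (rule fun_cong)
  have "((\<lambda>y. ?h (?g y)) has_derivative (\<lambda>w. h' (g' w))) (at (c p))"
    using has_derivative_compose[OF g', of ?h h'] h' cp by simp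
  then have "((\<lambda>y. y) has_derivative (\<lambda>w. h' (g' w))) (at (c p))"
    by (rule has_derivative_transform_within_open[OF _ op(1)])
      (use U p inj in \<open>auto simp: the_inv_into_f_f subset_iff\<close>)
  then have "(\<lambda>w. h' (g' w)) = (\<lambda>w. w)" by (rule has_derivative_unique[OF _ has_derivative_ident])
  then have hg: "h' (g' w) = w" for w by (rule fun_cong)
  show thesis
    using that[OF g' has_derivative_linear[OF g'] has_derivative_linear[OF h'] gh hg] .
qed

section \<open>Linear algebra of symplectic forms and of commuting affine maps\<close>

lemma dim_symplectic_complement:
  fixes \<omega> :: "'v::euclidean_space \<Rightarrow> 'v \<Rightarrow> real"
  assumes \<omega>: "symplectic_form \<omega>" and W: "subspace W"
  shows "dim {u. \<forall>w\<in>W. \<omega> u w = 0} + dim W = DIM('v)"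
proof -
  have bil: "bilinear \<omega>" using \<omega> by (simp add: symplectic_form_def)
  have alt: "\<omega> x y = - \<omega> y x" for x y
  proof -
    have "\<omega> (x + y) (x + y) = 0" "\<omega> x x = 0" "\<omega> y y = 0"
      using \<omega> by (auto simp: symplectic_form_def)
    then show ?thesis by (simp add: bilinear_ladd[OF bil] bilinear_radd[OF bil])
  qed
  \<comment> \<open>\<open>J w\<close> is the vector representing the functional
    \<open>\<lambda>u. \<omega> u w\<close> under the inner product.\<close>
  define J where "J w = (\<Sum>b\<in>Basis. \<omega> b w *\<^sub>R b)" for w
  have lin: "linear (\<omega> u)" "linear (\<lambda>x. \<omega> x u)" for u
    using bil by (auto simp: bilinear_def)
  have J: "\<omega> u w = J w \<bullet> u" for u w
  proof -
    have "\<omega> u w = \<omega> (\<Sum>b\<in>Basis. (u \<bullet> b) *\<^sub>R b) w" by (simp add: euclidean_representation)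
    also have "\<dots> = (\<Sum>b\<in>Basis. (u \<bullet> b) * \<omega> b w)"
      by (simp only: linear_sum[OF lin(2)] linear_scale[OF lin(2)] real_scaleR_def)
    also have "\<dots> = J w \<bullet> u"
      by (simp add: J_def inner_sum_left mult.commute inner_commute[of u])
    finally show ?thesis .
  qed
  have linJ: "linear J"
    by (rule linearI)
      (simp_all add: J_def bilinear_radd[OF bil] bilinear_rmul[OF bil] scaleR_left_distrib
        sum.distrib scaleR_sum_right)
  have "w = 0" if "J w = 0" for w
  proof -
    have "\<omega> w u = 0" for u using J[of u w] alt[of w u] that by simp
    then show ?thesis using \<omega> unfolding symplectic_form_def by blast
  qed
  then have "inj J" by (simp add: linear_injective_0[OF linJ])
  then have JW: "dim (J ` W) = dim W" 
    by (rule dim_image_eq[OF linJ inj_on_subset[OF _ subset_UNIV]])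
  have sub: "subspace (J ` W)" by (rule linear_subspace_image[OF linJ W])
  have "{u. \<forall>w\<in>W. \<omega> u w = 0} = {u \<in> UNIV. \<forall>x\<in>J ` W. orthogonal x u}"
    by (auto simp: J orthogonal_def)
  then show ?thesis
    using dim_subspace_orthogonal_to_vectors[of "J ` W" UNIV] sub JW by simp
qed

text \<open>Commutativity makes \<open>(A\<^sub>u - 1) v\<close> symmetric in \<open>u\<close> and \<open>v\<close>; being linear in \<open>v\<close>, it is then
  linear in \<open>u\<close> too.\<close>

lemma abelian_simply_transitive_aff:
  fixes H :: "'m::finite aff set"
  assumes comm: "comm_group (aff_group\<lparr>carrier := H\<rparr>)" and bij: "bij_betw orbit_map H UNIV"
  obtains B where "linear B" "H = range (\<lambda>u. (mat 1 + B u, u))"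
    "\<And>u v. B u *v v = B v *v u" "\<And>u v. B u ** B v = B v ** B u"
proof -
  have snd_eq: "orbit_map h = snd h" for h :: "'m aff" by (simp add: orbit_map_def aff_apply_def)
  define B where "B u = fst (the_inv_into H orbit_map u) - mat 1" for u
  have sec: "the_inv_into H orbit_map u = (mat 1 + B u, u)" for u
    using f_the_inv_into_f_bij_betw[OF bij, of u] by (simp add: B_def snd_eq prod_eq_iff)
  have H: "H = range (\<lambda>u. (mat 1 + B u, u))"
    using bij_betw_the_inv_into[OF bij] by (simp add: bij_betw_def sec)
  have "(mat 1 + B u, u) \<otimes>\<^bsub>aff_group\<^esub> (mat 1 + B v, v) = (mat 1 + B v, v) \<otimes>\<^bsub>aff_group\<^esub> (mat 1 + B u, u)"
    for u v
    using comm_groupE(4)[OF comm, of "(mat 1 + B u, u)" "(mat 1 + B v, v)"] H by auto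
  \<comment> \<open>The linear parts of the two products give commuting matrices, the translation
    parts give the symmetry of \<open>B u *v v\<close>.\<close>
  then have "(mat 1 + B u) ** (mat 1 + B v) = (mat 1 + B v) ** (mat 1 + B u)"
    and *: "(mat 1 + B u) *v v + u = (mat 1 + B v) *v u + v" for u v
    by (simp_all add: aff_group_def)
  then have "(mat 1 + B u) *v ((mat 1 + B v) *v x) = (mat 1 + B v) *v ((mat 1 + B u) *v x)" for u v x
    by (simp add: matrix_vector_mul_assoc)
  then have BB: "B u ** B v = B v ** B u" for u v
    by (simp add: matrix_eq matrix_vector_mul_assoc[symmetric] algebra_simps)
  from * have B: "B u *v v = B v *v u" for u v
    by (simp add: algebra_simps)
  have "linear B"
  proof (rule linearI)
    fix x y r
    have "B (x + y) *v v = B x *v v + B y *v v" for v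
      unfolding B[of _ v] by (rule matrix_vector_right_distrib)
    then show "B (x + y) = B x + B y"
      by (simp add: matrix_eq matrix_vector_mult_add_rdistrib)
    have "B (r *\<^sub>R x) *v v = r *\<^sub>R (B x *v v)" for v
      unfolding B[of _ v] by (rule matrix_vector_mult_scaleR)
    then show "B (r *\<^sub>R x) = r *\<^sub>R B x"
      by (simp add: matrix_eq scaleR_matrix_vector_assoc)
  qed
  then show thesis using that H B BB by blast
qed

text \<open>Replacing \<open>u\<close> by \<open>- u\<close> separates invariance under \<open>1 + B\<^sub>u\<close> into its linear and quadratic
  parts; the quadratic part gives \<open>B\<^sub>u\<^sup>2 = 0\<close>, whose polarization is \<open>2 B\<^sub>u B\<^sub>v = 0\<close>.\<close>

lemma symplectic_linear_parts:
  fixes \<omega> :: "real^'m \<Rightarrow> real^'m \<Rightarrow> real" and B :: "real^'m \<Rightarrow> real^'m^'m"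
  assumes \<omega>: "symplectic_form \<omega>" and lin: "linear B"
    and BB: "\<And>u v. B u ** B v = B v ** B u"
    and inv: "\<And>u x y. \<omega> ((mat 1 + B u) *v x) ((mat 1 + B u) *v y) = \<omega> x y"
  shows "\<omega> (B u *v x) y = - \<omega> x (B u *v y)" and "B u *v (B v *v x) = 0"
proof -
  have bil: "bilinear \<omega>" using \<omega> by (simp add: symplectic_form_def)
  note bs = bilinear_ladd[OF bil] bilinear_radd[OF bil] bilinear_lneg[OF bil] bilinear_rneg[OF bil]
    matrix_vector_mult_add_rdistrib bilinear_lzero[OF bil] bilinear_rzero[OF bil]
  have 1: "\<omega> (B u *v x) y + \<omega> x (B u *v y) + \<omega> (B u *v x) (B u *v y) = 0" for u x y
    using inv[of u x y] by (simp add: bs)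
  have neg: "B (- u) *v x = - (B u *v x)" for u x
    using linear_neg[OF lin, of u] by (simp add: vec_eq_iff matrix_vector_mult_def sum_negf)
  have 2: "- \<omega> (B u *v x) y - \<omega> x (B u *v y) + \<omega> (B u *v x) (B u *v y) = 0" for u x y
    using 1[of "- u" x y] by (simp add: bs neg)
  show skew: "\<omega> (B u *v x) y = - \<omega> x (B u *v y)" for u x y
    using 1[of u x y] 2[of u x y] by linarith
  \<comment> \<open>Adding \<open>1\<close> and \<open>2\<close> kills
    \<open>\<omega> (B u *v x) (B u *v y)\<close>; skewness moves the second \<open>B u\<close> to
    the left, and nondegeneracy finishes.\<close>
  have sq: "B u *v (B u *v x) = 0" for u x
  proof -
    have "\<omega> (B u *v (B u *v x)) y = 0" for y
      using 1[of u x y] 2[of u x y] skew[of u "B u *v x" y] by linarith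
    then show ?thesis using \<omega> unfolding symplectic_form_def by blast
  qed
  have "B (u + v) *v (B (u + v) *v x) = B u *v (B u *v x) + B v *v (B v *v x)
      + (B u *v (B v *v x) + B v *v (B u *v x))"
    by (simp add: linear_add[OF lin] matrix_vector_mult_add_rdistrib matrix_vector_right_distrib)
  moreover have "B v *v (B u *v x) = B u *v (B v *v x)"
    by (simp add: matrix_vector_mul_assoc BB)
  ultimately have "B u *v (B v *v x) + B u *v (B v *v x) = 0" by (simp add: sq)
  then show "B u *v (B v *v x) = 0"
    by (simp add: vec_eq_iff)
qed

section \<open>The Lie algebra and the subgroup of translations\<close>

text \<open>As \<open>H\<close> is the graph of \<open>B\<close> over the translation parts, shifted
  by \<open>mat 1\<close>, its tangent space at the identity is the graph of \<open>B\<close>. The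
  differential of the orbit map is the projection \<open>snd\<close>, whose inverse on that graph
  sends \<open>X\<close> to \<open>(B X, X)\<close>.\<close>

lemma linear_part_of_eq:
  fixes \<A> :: "('m::finite aff, 'e::euclidean_space) atlas"
  assumes A: "smooth_atlas H \<A>" and st: "simply_transitive H \<A>"
    and one: "\<one>\<^bsub>aff_group\<^esub> \<in> H" and lin: "linear B" and H: "H = range (\<lambda>u. (mat 1 + B u, u))"
  shows "linear_part_of \<A> X = B X"
proof -
  have snd_eq: "orbit_map = (snd :: 'm aff \<Rightarrow> _)"
    by (simp add: fun_eq_iff orbit_map_def aff_apply_def)
  note st = st[unfolded simply_transitive_def]
  let ?e = "\<one>\<^bsub>aff_group\<^esub> :: 'm aff"
  have tangent: "range (frechet_derivative (the_inv_into U c) (at (c ?e))) = range (\<lambda>v. (B v, v))"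
    if c: "(U, c) \<in> \<A>" and e: "?e \<in> U" for U c
  proof -
    obtain g' h' where g': "((\<lambda>y. orbit_map (the_inv_into U c y)) has_derivative g') (at (c ?e))"
      and gh: "\<And>v. g' (h' v) = v"
      using diffeomorphism_derivative_in_chart[OF A st c e] by metis
    have U: "U \<subseteq> H" "inj_on c U" using A c by (auto simp: smooth_atlas_def)
    have "bounded_linear (\<lambda>v. (B v, v))"
      using lin by (simp add: bounded_linear_Pair linear_conv_bounded_linear bounded_linear_ident)
    \<comment> \<open>An inverse chart factors through the orbit map followed by the affine map
      \<open>v \<mapsto> (mat 1 + B v, v)\<close>, which reduces its derivative to
      \<open>g'\<close>.\<close>
    then have "((\<lambda>y. (\<lambda>v. (B v, v)) (orbit_map (the_inv_into U c y)) + (mat 1, 0))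
        has_derivative (\<lambda>w. (\<lambda>v. (B v, v)) (g' w))) (at (c ?e))"
      using has_derivative_add_const[OF bounded_linear.has_derivative[OF _ g']] by blast
    then have "(the_inv_into U c has_derivative (\<lambda>w. (B (g' w), g' w))) (at (c ?e))"
    proof (rule has_derivative_transform_within_open)
      show "open (c ` U)" "c ?e \<in> c ` U"
        using diffeomorphism_onto_UNIV_D(2)[OF st c] e by (auto simp: smooth_on_def)
      fix y assume "y \<in> c ` U"
      then have "the_inv_into U c y \<in> H" using U by (auto simp: the_inv_into_f_f)
      then show "(\<lambda>v. (B v, v)) (orbit_map (the_inv_into U c y)) + (mat 1, 0) = the_inv_into U c y"
        unfolding H by (auto simp: snd_eq add.commute)
    qed
    then have "frechet_derivative (the_inv_into U c) (at (c ?e)) = (\<lambda>w. (B (g' w), g' w))"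
      by (simp add: frechet_derivative_at[symmetric])
    \<comment> \<open>Surjectivity of \<open>g'\<close> ensures that the whole graph is reached, not
      only a subspace of it.\<close>
    moreover have "range g' = UNIV" using gh by (metis surjI)
    ultimately show ?thesis
      using image_image[of "\<lambda>v. (B v, v)" g' UNIV] by simp
  qed
  obtain U c where c: "(U, c) \<in> \<A>" "?e \<in> U"
    using A one by (auto simp: smooth_atlas_def)
  have L: "lie_algebra \<A> = range (\<lambda>v. (B v, v))"
  proof -
    have "lie_algebra \<A> = (\<Union>(U, c)\<in>{(U, c) \<in> \<A>. ?e \<in> U}.
        range (frechet_derivative (the_inv_into U c) (at (c ?e))))"
      by (fastforce simp: lie_algebra_def tangent_space_def)
    also have "\<dots> = (\<Union>(U, c)\<in>{(U, c) \<in> \<A>. ?e \<in> U}. range (\<lambda>v. (B v, v)))"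
      by (rule SUP_cong[OF refl])
        (simp only: split_paired_all mem_Collect_eq prod.case tangent)
    \<comment> \<open>The union over charts collapses because all members are equal and the chart
      \<open>(U, c)\<close> around the identity makes it nonempty.\<close>
    also have "\<dots> = range (\<lambda>v. (B v, v))" using c by auto
    finally show ?thesis .
  qed
  have "frechet_derivative orbit_map (at ?e) = snd"
    by (simp add: snd_eq frechet_derivative_at[OF has_derivative_snd[OF has_derivative_ident], symmetric])
  moreover have "the_inv_into (lie_algebra \<A>) snd X = (B X, X)"
    by (rule the_inv_into_f_eq) (auto simp: L inj_on_def)
  ultimately show ?thesis by (simp add: linear_part_of_def)
qed

lemma subgroup_translation_subgroup:
  assumes "group (aff_group\<lparr>carrier := H\<rparr>)"
  shows "subgroup (translation_subgroup H) (aff_group\<lparr>carrier := H\<rparr>)"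
proof -
  interpret group "aff_group\<lparr>carrier := H\<rparr>" by fact
  show ?thesis
  proof
    show "translation_subgroup H \<subseteq> carrier (aff_group\<lparr>carrier := H\<rparr>)"
      by (auto simp: translation_subgroup_def)
    show "\<one>\<^bsub>aff_group\<lparr>carrier := H\<rparr>\<^esub> \<in> translation_subgroup H"
      using one_closed by (simp add: translation_subgroup_def aff_group_def)
    show "x \<otimes>\<^bsub>aff_group\<lparr>carrier := H\<rparr>\<^esub> y \<in> translation_subgroup H"
      if "x \<in> translation_subgroup H" "y \<in> translation_subgroup H" for x y
      using that m_closed[of x y] by (simp add: translation_subgroup_def aff_group_def)
    \<comment> \<open>The first component of \<open>r_inv\<close> reads
      \<open>mat 1 ** A = mat 1\<close>, where \<open>A\<close> is the linear part of the
      inverse.\<close>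
    show "inv\<^bsub>aff_group\<lparr>carrier := H\<rparr>\<^esub> x \<in> translation_subgroup H"
      if "x \<in> translation_subgroup H" for x
      using that inv_closed[of x] r_inv[of x] by (simp add: translation_subgroup_def aff_group_def)
  qed
qed

section \<open>The translations as a slice, and its dimension\<close>

theorem corollary4:
  fixes \<omega> :: "real^'m \<Rightarrow> real^'m \<Rightarrow> real"
    and n k :: nat
    and H :: "('m::finite) aff set"
    and \<A> :: "('m aff, 'e::euclidean_space) atlas"
    and S :: "real^'m \<Rightarrow> real^'m \<Rightarrow> real^'m \<Rightarrow> real"
  assumes "CARD('m) = 2 * n"
    and "symplectic_form \<omega>"
    and "affine_group_of_symplectic_type \<omega> H \<A>"
    and "comm_group (aff_group\<lparr>carrier := H\<rparr>)"
    and "simply_transitive H \<A>"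
    and "S = cubic_form \<omega> \<A>"
    and "k = dim (cubic_support \<omega> S)"
  shows "embedded_lie_subgroup_of_dim (aff_group\<lparr>carrier := H\<rparr>) \<A> (translation_subgroup H) (2 * n - k) \<and> k \<le> n"
proof -
  note \<omega> = assms(2)
  have bil: "bilinear \<omega>" using \<omega> by (simp add: symplectic_form_def)
  have grp: "group (aff_group\<lparr>carrier := H\<rparr>)" using assms(4) by (simp add: comm_group_def)
  have one: "\<one>\<^bsub>aff_group\<^esub> \<in> H" using group.is_monoid[OF grp] monoid.one_closed by force
  have A: "smooth_atlas H \<A>"
    and sympl: "\<And>h x y. h \<in> H \<Longrightarrow> \<omega> (fst h *v x) (fst h *v y) = \<omega> x y"
    using assms(3) by (auto simp: affine_group_of_symplectic_type_def connected_lie_subgroup_def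
        lie_subgroup_def lie_group_def smooth_manifold_def)
  have st: "diffeomorphism H \<A> UNIV (open_atlas UNIV) orbit_map"
    using assms(5) by (simp add: simply_transitive_def)
  obtain B where lin: "linear B" and H: "H = range (\<lambda>u. (mat 1 + B u, u))"
    and B: "\<And>u v. B u *v v = B v *v u" and BB: "\<And>u v. B u ** B v = B v ** B u"
    using abelian_simply_transitive_aff[OF assms(4)] st by (auto simp: diffeomorphism_def)
  have inv: "\<omega> ((mat 1 + B u) *v x) ((mat 1 + B u) *v y) = \<omega> x y" for u x y
    using sympl[of "(mat 1 + B u, u)"] H by auto
  note skew = symplectic_linear_parts(1)[OF \<omega> lin BB inv]
    and nil = symplectic_linear_parts(2)[OF \<omega> lin BB inv]

  define \<Sigma> where "\<Sigma> = cubic_support \<omega> S"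
  have \<Sigma>: "\<Sigma> = span {B X *v Y | X Y. True}"
    unfolding \<Sigma>_def assms(6) cubic_support_cubic_form[OF \<omega>]
    by (simp add: linear_part_of_eq[OF A assms(5) one lin H])
  let ?P = "{u. \<forall>w\<in>\<Sigma>. \<omega> u w = 0}"
  have ortho: "u \<in> ?P \<longleftrightarrow> (\<forall>x y. \<omega> u (B x *v y) = 0)" for u
  proof
    assume u: "\<forall>x y. \<omega> u (B x *v y) = 0"
    have "linear (\<omega> u)" using bil by (simp add: bilinear_def)
    have "\<omega> u w = 0" if "w \<in> span {B X *v Y | X Y. True}" for w
      using linear_eq_0_on_span[OF \<open>linear (\<omega> u)\<close> _ that] u by blast
    then show "u \<in> ?P" by (simp add: \<Sigma>)
  qed (auto simp: \<Sigma> intro: span_base)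
  have ker: "?P = {u. B u = 0}"
  proof -
    \<comment> \<open>Skewness followed by the symmetry \<open>B x *v u = B u *v x\<close>: pairing
      \<open>u\<close> with the generators of \<Sigma> tests exactly whether \<open>B u\<close>
      vanishes.\<close>
    have "\<omega> u (B x *v y) = - \<omega> (B u *v x) y" for u x y
      using skew[of x u y] B[of x u] by simp
    then have "u \<in> ?P \<longleftrightarrow> (\<forall>x. B u *v x = 0)" for u
      using \<omega> bilinear_lzero[OF bil] unfolding ortho symplectic_form_def
      by (metis neg_equal_0_iff_equal)
    then show ?thesis by (auto simp: matrix_eq)
  qed
  have P: "subspace {u. B u = 0}"
    by (simp add: subspace_def linear_add[OF lin] linear_0[OF lin] linear_scale[OF lin])
  \<comment> \<open>By symmetry, applying this matrix to \<open>z\<close> gives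
    \<open>B z *v (B x *v y)\<close>, a product of two linear parts, which is zero.\<close>
  have "B (B x *v y) = 0" for x y
    unfolding matrix_eq B[of "B x *v y"] by (simp add: nil)
  then have "\<Sigma> \<subseteq> {u. B u = 0}"
    unfolding \<Sigma> using P by (intro span_minimal) auto
  then have "dim \<Sigma> \<le> dim ?P" unfolding ker by (rule dim_subset)
  moreover have dimP: "dim ?P + k = 2 * n"
    using dim_symplectic_complement[OF \<omega>, of \<Sigma>] assms(1,7) by (simp add: \<Sigma>_def cubic_support_def)
  \<comment> \<open>The inclusion gives \<open>k \<le> dim ?P\<close>, and
    \<open>dim ?P + k = 2 * n\<close>, so \<open>2 * k \<le> 2 * n\<close>.\<close>
  ultimately have "k \<le> n" using assms(7) by (simp add: \<Sigma>_def)

  \<comment> \<open>The derivative of the orbit map in any chart at the identity supplies the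
    isomorphism between \<open>real^'m\<close> and the model space.\<close>
  obtain U c where "(U, c) \<in> \<A>" "\<one>\<^bsub>aff_group\<^esub> \<in> U"
    using A one by (auto simp: smooth_atlas_def)
  then obtain L L' where L: "linear (L :: real^'m \<Rightarrow> 'e)" "linear L'"
    "\<And>x. L' (L x) = x" "\<And>y. L (L' y) = y"
    using diffeomorphism_derivative_in_chart[OF A st] by metis
  have injL: "inj L" using L(3) by (metis injI)
  \<comment> \<open>In this global chart the element \<open>(mat 1 + B u, u)\<close> has coordinate
    \<open>L u\<close> and is a translation iff \<open>B u = 0\<close>. One chart and one subspace
    therefore serve as slice at every point.\<close>
  let ?c = "\<lambda>h. L (orbit_map h)" and ?W = "L ` {u. B u = 0}"
  have "subspace ?W" using P L(1) by (simp add: linear_subspace_image)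
  moreover have "dim ?W = 2 * n - k"
    using dimP dim_image_eq[OF L(1) inj_on_subset[OF injL subset_UNIV]] by (simp add: ker)
  moreover have "?c ` (H \<inter> translation_subgroup H) = ?c ` H \<inter> ?W"
    using injL unfolding H
    by (auto simp: translation_subgroup_def orbit_map_def aff_apply_def inj_eq image_iff)
  ultimately have "embedded_submanifold H \<A> (translation_subgroup H) (2 * n - k)"
    using smooth_atlas_insert_global_chart[OF A st L] unfolding embedded_submanifold_def
    by (auto simp: translation_subgroup_def intro!: exI[of _ H] exI[of _ ?c] exI[of _ ?W])
  then show ?thesis
    using subgroup_translation_subgroup[OF grp] \<open>k \<le> n\<close>
    by (simp add: embedded_lie_subgroup_of_dim_def)
qed

end
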